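(* Let $D_1$ and $D_2$ be oriented graphs such that $\operatorname{inv}(D_1)=2$ and $\operatorname{inv}(D_2)=k$. Then either (i) $\operatorname{inv}(D_1\rightarrow D_2)=k+2$; or (ii) $\operatorname{inv}(D_1\rightarrow D_2)=k+1$, in which case $k$ is odd. Moreover, $\operatorname{inv}(D_1\rightarrow D_2)=k+1$ if and only if $\operatorname{inv}(\overrightarrow{C_3}\rightarrow D_2)=k$.
   Context: An oriented graph is a finite simple oriented graph: no loops and at most one arc between any two vertices. For an oriented graph $D$ and $X\subseteq V(D)$, the inversion of $X$ in $D$ is the oriented graph obtained by reversing the orientation of every arc with both ends in $X$. A family $X_1,\dots,X_m$ of subsets of $V(D)$ is a decycling family for $D$ if successively inverting all of $X_1,\dots,X_m$ (the order does not matter) yields an oriented graph with no directed cycle. The inversion number $\operatorname{inv}(D)$ is the smallest integer $m\ge 0$ for which there is a decycling family of $m$ sets for $D$. The dijoin $D_1\rightarrow D_2$ is the oriented graph obtained from the disjoint union of $D_1$ and $D_2$ by adding an arc from $u$ to $v$ for every $u\in V(D_1)$ and $v\in V(D_2)$. $\overrightarrow{C_3}$ denotes the directed cycle on 3 vertices. *)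

theory Defs
  imports "Graph_Theory.Graph_Theory"
begin

text \<open>
  Together with \<open>pair_digraph\<close> (finite, arcs between vertices, no loops, no parallel arcs) the extra
  assumption excludes digons, so that any two vertices are joined by at most one arc.
\<close>
locale oriented_graph = pair_digraph +
  assumes no_digon: "(u, v) \<in> parcs G \<Longrightarrow> (v, u) \<notin> parcs G"

definition invert :: "'a set \<Rightarrow> 'a pair_pre_digraph \<Rightarrow> 'a pair_pre_digraph" where
  "invert X D = \<lparr> pverts = pverts D, parcs = swap_in (X \<times> X) ` parcs D \<rparr>"

definition no_directed_cycle :: "'a pair_pre_digraph \<Rightarrow> bool" where
  "no_directed_cycle D \<longleftrightarrow> (\<nexists>p. pre_digraph.cycle (with_proj D) p)"

text \<open>A family is a list of sets; repeated and empty members are allowed.\<close>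
definition decycling_family :: "'a pair_pre_digraph \<Rightarrow> 'a set list \<Rightarrow> bool" where
  "decycling_family D Xs \<longleftrightarrow>
     (\<forall>X \<in> set Xs. X \<subseteq> pverts D) \<and> no_directed_cycle (fold invert Xs D)"

text \<open>
  The minimum exists for every oriented graph: fix a linear order of the vertices and invert the pair
  of endpoints of each arc that goes backwards.
\<close>
definition inversion_number :: "'a pair_pre_digraph \<Rightarrow> nat" where
  "inversion_number D = (LEAST m. \<exists>Xs. length Xs = m \<and> decycling_family D Xs)"

definition dijoin ::
    "'a pair_pre_digraph \<Rightarrow> 'b pair_pre_digraph \<Rightarrow> ('a + 'b) pair_pre_digraph" where
  "dijoin D1 D2 = \<lparr> pverts = pverts D1 <+> pverts D2,
     parcs = {(Inl u, Inl v) | u v. (u, v) \<in> parcs D1}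
           \<union> {(Inr u, Inr v) | u v. (u, v) \<in> parcs D2}
           \<union> {(Inl u, Inr v) | u v. u \<in> pverts D1 \<and> v \<in> pverts D2} \<rparr>"

definition directed_C3 :: "nat pair_pre_digraph" where
  "directed_C3 = \<lparr> pverts = {0, 1, 2}, parcs = {(0, 1), (1, 2), (2, 0)} \<rparr>"

end

theory Submission
  imports Defs "HOL-Library.Z2"
begin

text \<open>
  Record a family of \<open>m\<close> sets by giving each vertex its incidence vector in \<open>F\<^sub>2\<^sup>m\<close>: an arc is reversed
  iff the vectors of its ends have scalar product 1. Given a decycling family of \<open>D1 \<rightarrow> D2\<close>, every
  vector \<open>u\<close> of \<open>D1\<close> cuts out an initial segment \<open>{v. u \<bullet> v = 1}\<close> of the resulting order on \<open>D2\<close>,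
  and these segments are nested. Reversing segments keeps \<open>D2\<close> acyclic, so the scalar product on
  \<open>D2\<close> may be modified by products of the linear forms \<open>u \<bullet> _\<close>, which can lower its rank.
  If \<open>inv D1 \<ge> 2\<close>, then \<open>D1\<close> contains two vectors allowing the rank to drop by 2; otherwise its Gram
  matrix would have rank one and a single set would decycle it. Similarly \<open>C\<^sub>3\<close> allows a drop by 1.
  The remaining form on \<open>D2\<close> gives a decycling family of as many sets as its rank unless it is
  alternating, in which case the rank is even. Hence \<open>inv (D1 \<rightarrow> D2) = k + 1\<close> and
  \<open>inv (C\<^sub>3 \<rightarrow> D2) = k\<close> are both equivalent to: \<open>k\<close> is odd and \<open>D2\<close> has a decycling family of \<open>k\<close>
  sets covering every vertex an even number of times.
\<close>

section \<open>Gram matrices over the field with two elements\<close>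

declare add_bit_eq_xor [simp del] mult_bit_eq_and [simp del]

lemma bit_add_self [simp]: "x + x = (0::bit)"
  by (cases x) simp_all

definition dot :: "'i set \<Rightarrow> ('i \<Rightarrow> bit) \<Rightarrow> ('i \<Rightarrow> bit) \<Rightarrow> bit" where
  "dot I a b = (\<Sum>i\<in>I. a i * b i)"

lemma dot_commute: "dot I a b = dot I b a"
  by (simp add: dot_def mult.commute)

lemma dot_add_left: "dot I (\<lambda>i. a i + b i) c = dot I a c + dot I b c"
  by (simp add: dot_def distrib_right sum.distrib)

lemma dot_add_right: "dot I c (\<lambda>i. a i + b i) = dot I c a + dot I c b"
  by (simp add: dot_def distrib_left sum.distrib)

lemma dot_scale_left: "dot I (\<lambda>i. s * a i) b = s * dot I a b"
  by (simp add: dot_def sum_distrib_left mult.assoc)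

lemma dot_scale_right: "dot I b (\<lambda>i. s * a i) = s * dot I b a"
  by (simp add: dot_def sum_distrib_left mult.left_commute)

lemma dot_unit_left: "finite I \<Longrightarrow> j \<in> I \<Longrightarrow> dot I (\<lambda>i. of_bool (i = j)) b = b j"
  by (simp add: dot_def of_bool_def if_distrib [of "\<lambda>x. x * _"] cong: if_cong)

lemma dot_unit_right: "finite I \<Longrightarrow> j \<in> I \<Longrightarrow> dot I b (\<lambda>i. of_bool (i = j)) = b j"
  by (subst dot_commute) (rule dot_unit_left)

lemmas dot_bilinear = dot_add_left dot_add_right dot_scale_left dot_scale_right

lemma dot_remove: "finite I \<Longrightarrow> a j = 0 \<Longrightarrow> dot (I - {j}) a b = dot I a b"
  unfolding dot_def by (rule sum.mono_neutral_left) auto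

lemma dot_self: "dot I a a = (\<Sum>i\<in>I. a i)"
  unfolding dot_def by (rule sum.cong) auto

lemma dot_reindex: "bij_betw h J I \<Longrightarrow> dot J (\<lambda>i. a (h i)) (\<lambda>i. b (h i)) = dot I a b"
  unfolding dot_def by (rule sum.reindex_bij_betw)

definition gram :: "nat \<Rightarrow> ('v \<Rightarrow> 'v \<Rightarrow> bit) \<Rightarrow> bool" where
  "gram m M \<longleftrightarrow> (\<exists>a. \<forall>x y. M x y = dot {..<m} (a x) (a y))"

text \<open>The zero diagonal says that the vectors are even. For even \<open>m > 0\<close>, adding
  the all-ones vector wherever a fixed coordinate is 1 clears that coordinate without changing the
  form, so an alternating form can resist shortening only in odd length.\<close>

definition even_gram :: "nat \<Rightarrow> ('v \<Rightarrow> 'v \<Rightarrow> bit) \<Rightarrow> bool" where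
  "even_gram m M \<longleftrightarrow> gram m M \<and> (\<forall>x. M x x = 0) \<and> odd m"

lemma gramI:
  assumes "finite I" and "\<And>x y. M x y = dot I (a x) (a y)"
  shows "gram (card I) M"
proof -
  obtain h where "bij_betw h {..<card I} I"
    using ex_bij_betw_nat_finite [OF assms(1)] by (auto simp: lessThan_atLeast0)
  then have "\<forall>x y. M x y = dot {..<card I} (\<lambda>i. a x (h i)) (\<lambda>i. a y (h i))"
    using assms(2) dot_reindex by metis
  then show ?thesis
    unfolding gram_def by (intro exI [of _ "\<lambda>x i. a x (h i)"])
qed

lemma gram_pullback:
  assumes "gram m B" and "\<And>x y. M x y = B (f x) (f y)"
  shows "gram m M"
proof -
  obtain a where "\<forall>x y. B x y = dot {..<m} (a x) (a y)"
    using assms(1) unfolding gram_def by auto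
  then show ?thesis
    unfolding gram_def by (intro exI [of _ "\<lambda>x. a (f x)"]) (simp add: assms(2))
qed

lemma even_gram_pullback:
  assumes "even_gram m B" and "\<And>x y. M x y = B (f x) (f y)"
  shows "even_gram m M"
  using assms gram_pullback [of m B M f] unfolding even_gram_def by auto

text \<open>An alternating form of rank \<open>m\<close> is the Gram matrix of vectors of length \<open>m + 1\<close> but of no shorter
  ones; every other form of rank \<open>m\<close> is a Gram matrix of vectors of length \<open>m\<close>.\<close>

definition almost_gram :: "nat \<Rightarrow> ('v \<Rightarrow> 'v \<Rightarrow> bit) \<Rightarrow> bool" where
  "almost_gram m M \<longleftrightarrow> gram m M \<or> even_gram (m + 1) M"

lemma almost_gram_pullback:
  assumes "almost_gram m B" and "\<And>x y. M x y = B (f x) (f y)"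
  shows "almost_gram m M"
  using assms gram_pullback [of m B M f] even_gram_pullback [of "m + 1" B M f]
  unfolding almost_gram_def by auto

text \<open>The orthogonal projection along \<open>v\<close>, followed by the transvection in direction
  \<open>v + e\<^sub>j\<close>, which moves \<open>v\<close> to the unit vector \<open>e\<^sub>j\<close>.\<close>

lemma dot_eliminate_coordinate:
  assumes I: "finite I" and j: "j \<in> I" "v j = 0" and v: "dot I v v = 1"
  defines "\<phi> \<equiv> \<lambda>b i. b i + ((dot I v b + b j) * v i + b j * of_bool (i = j))"
  shows "dot (I - {j}) (\<phi> b) (\<phi> c) = dot I b c + dot I v b * dot I v c"
proof -
  have "\<phi> b j = 0" using j(2) by (simp add: \<phi>_def)
  then have "dot (I - {j}) (\<phi> b) (\<phi> c) = dot I (\<phi> b) (\<phi> c)"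
    by (rule dot_remove [OF I])
  also have "\<dots> = dot I b c + dot I v b * dot I v c"
    unfolding \<phi>_def
    by (simp add: dot_bilinear dot_unit_left [OF I j(1)] dot_unit_right [OF I j(1)] j(2) v
          dot_commute [of I b v])
      (cases "dot I v b"; cases "dot I v c"; cases "b j"; cases "c j"; simp add: add_ac)
  finally show ?thesis .
qed

section \<open>Splitting off odd vectors and hyperbolic planes\<close>

lemma odd_dot_ones: "dot I v v = 1 \<Longrightarrow> (\<And>i. i \<in> I \<Longrightarrow> v i = 1) \<Longrightarrow> odd (card I)"
  using even_of_nat [of "card I", where ?'a = bit] by (simp add: dot_def)

text \<open>Squaring is the identity on \<open>bit\<close>, so pairing with the all-ones vector
  gives \<open>dot I b b\<close>. The orthogonal projection along it therefore produces even vectors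
  only.\<close>

lemma dot_project_ones:
  assumes "\<And>i. i \<in> I \<Longrightarrow> v i = 1" and v: "dot I v v = 1"
  defines "\<phi> \<equiv> \<lambda>b i. b i + dot I v b * v i"
  shows "dot I (\<phi> b) (\<phi> c) = dot I b c + dot I v b * dot I v c"
    and "dot I b b + dot I v b * dot I v b = 0"
proof -
  show "dot I (\<phi> b) (\<phi> c) = dot I b c + dot I v b * dot I v c"
    unfolding \<phi>_def
    by (cases "dot I v b"; cases "dot I v c"; simp add: dot_bilinear v dot_commute [of I b v])
  have "dot I v b = dot I b b"
    unfolding dot_self using assms(1) by (simp add: dot_def)
  then show "dot I b b + dot I v b * dot I v b = 0"
    by (cases "dot I v b") simp_all
qed

text \<open>If \<open>v\<close> has a zero coordinate, the projection along \<open>v\<close> can be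
  moved off that coordinate. Otherwise \<open>v\<close> is all ones, no coordinate is saved, and the
  projected vectors form the alternating case of \<open>almost_gram\<close>.\<close>

lemma almost_gram_split_odd:
  assumes I: "finite I" "card I = n + 1" and v: "dot I v v = 1"
  shows "almost_gram n (\<lambda>b c. dot I b c + dot I v b * dot I v c)" (is "almost_gram n ?B")
proof (cases "\<exists>j\<in>I. v j = 0")
  case True
  then obtain j where j: "j \<in> I" "v j = 0" by auto
  have "gram (card (I - {j})) ?B"
    by (rule gramI, use I in simp, rule dot_eliminate_coordinate [OF I(1) j v, symmetric])
  then show ?thesis
    using I j(1) by (simp add: almost_gram_def)
next
  case False
  then have 1: "\<And>i. i \<in> I \<Longrightarrow> v i = 1" by auto
  have "gram (card I) ?B"
    by (rule gramI [OF I(1)], rule dot_project_ones(1) [OF 1 v, symmetric])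
  moreover have "odd (card I)"
    by (rule odd_dot_ones [OF v 1])
  ultimately show ?thesis
    using dot_project_ones(2) [OF 1 v] I(2) by (simp add: almost_gram_def even_gram_def)
qed

text \<open>\<open>v\<close> is not all ones, since otherwise \<open>dot I v w\<close> would equal
  \<open>dot I w w\<close>. So splitting off \<open>v\<close> saves a coordinate; the image of
  \<open>w\<close> stays odd because \<open>w\<close> is orthogonal to \<open>v\<close>, and it is
  split off next.\<close>

lemma almost_gram_split_orthogonal_odd:
  assumes I: "finite I" and v: "dot I v v = 1" and w: "dot I w w = 1" and vw: "dot I v w = 0"
  shows "\<exists>n. card I = n + 2 \<and>
    almost_gram n (\<lambda>b c. dot I b c + dot I v b * dot I v c + dot I w b * dot I w c)"
    (is "\<exists>n. _ \<and> almost_gram n ?B")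
proof -
  have "\<exists>j\<in>I. v j = 0"
  proof (rule ccontr)
    assume "\<not> ?thesis"
    then have "dot I v w = dot I w w" by (simp add: dot_self) (simp add: dot_def)
    then show False using vw w by simp
  qed
  then obtain j where j: "j \<in> I" "v j = 0" by auto
  define J where "J = I - {j}"
  define \<phi> where "\<phi> = (\<lambda>b i. b i + ((dot I v b + b j) * v i + b j * of_bool (i = j)))"
  have \<phi>: "dot J (\<phi> b) (\<phi> c) = dot I b c + dot I v b * dot I v c" for b c
    unfolding J_def \<phi>_def by (rule dot_eliminate_coordinate [OF I j v])
  have w': "dot J (\<phi> w) (\<phi> w) = 1" by (simp add: \<phi> w vw)
  then have "J \<noteq> {}" by (auto simp: dot_def)
  then obtain n where n: "card J = n + 1"
    using I by (metis J_def Suc_eq_plus1 card_eq_0_iff finite_Diff not0_implies_Suc)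
  have "almost_gram n (\<lambda>b c. dot J b c + dot J (\<phi> w) b * dot J (\<phi> w) c)"
    using I by (intro almost_gram_split_odd n w') (simp add: J_def)
  then have "almost_gram n ?B"
    by (rule almost_gram_pullback [where f = \<phi>]) (simp add: \<phi> vw)
  moreover have "card I = n + 2"
    using n card.remove [OF I j(1)] by (simp add: J_def)
  ultimately show ?thesis by blast
qed

text \<open>Project a unit vector onto the orthogonal complement of the plane spanned by
  \<open>u\<close> and \<open>w\<close>. All vectors of that plane are even, so the result stays
  odd.\<close>

lemma ex_odd_orthogonal:
  assumes I: "finite I" and u: "dot I u u = 0" and w: "dot I w w = 0" and uw: "dot I u w = 1"
  obtains c where "dot I c c = 1" "dot I u c = 0" "dot I w c = 0"
proof -
  have "I \<noteq> {}" using uw by (auto simp: dot_def)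
  then obtain j where j: "j \<in> I" by auto
  show thesis
    by (rule that [of "\<lambda>i. of_bool (i = j) + (w j * u i + u j * w i)"])
      (simp_all add: dot_bilinear dot_unit_left [OF I j] dot_unit_right [OF I j] u w uw
        dot_commute [of I w u]; cases "u j"; cases "w j"; simp)+
qed

text \<open>A hyperbolic plane \<open>\<langle>u, w\<rangle>\<close> has no orthonormal basis, but adding an odd vector \<open>c\<close> orthogonal
  to it gives a space with the orthonormal basis \<open>u + c\<close>, \<open>w + c\<close>, \<open>u + w + c\<close>. Rotating \<open>c\<close> to
  \<open>u + w + c\<close> reduces this to splitting off the first two of these vectors.\<close>

lemma almost_gram_split_hyperbolic:
  assumes I: "finite I" and u: "dot I u u = 0" and w: "dot I w w = 0" and uw: "dot I u w = 1"
  shows "\<exists>n. card I = n + 2 \<and>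
    almost_gram n (\<lambda>b c. dot I b c + (dot I u b * dot I w c + dot I w b * dot I u c))"
    (is "\<exists>n. _ \<and> almost_gram n ?B")
proof -
  obtain c where c: "dot I c c = 1" "dot I u c = 0" "dot I w c = 0"
    using ex_odd_orthogonal [OF assms] .
  define f where "f = (\<lambda>i. u i + c i)"
  define g where "g = (\<lambda>i. w i + c i)"
  define h where "h = (\<lambda>i. u i + (w i + c i))"
  \<comment> \<open>In the orthonormal system \<open>f\<close>, \<open>g\<close>, \<open>h\<close>
    the vector \<open>c\<close> is \<open>f + g + h\<close>. The map replaces the component of
    \<open>b\<close> in this span by \<open>dot I c b\<close> times \<open>h\<close>: it kills
    \<open>u\<close> and \<open>w\<close>, and its values are orthogonal to \<open>f\<close> and
    \<open>g\<close>.\<close>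
  define \<psi> where "\<psi> = (\<lambda>b i. b i + ((dot I u b + dot I c b) * f i +
    ((dot I w b + dot I c b) * g i + (dot I u b + dot I w b) * h i)))"
  note vals = u w uw c dot_commute [of I w u] dot_commute [of I c u] dot_commute [of I c w]
  have "dot I f f = 1" "dot I g g = 1" "dot I f g = 0"
    by (simp_all add: f_def g_def dot_bilinear vals)
  then obtain n where n: "card I = n + 2"
    and gram: "almost_gram n (\<lambda>b c. dot I b c + dot I f b * dot I f c + dot I g b * dot I g c)"
    using almost_gram_split_orthogonal_odd [OF I] by blast
  have f: "dot I f (\<psi> b) = 0" and g: "dot I g (\<psi> b) = 0" for b
    by (cases "dot I u b"; cases "dot I w b"; cases "dot I c b";
        simp add: \<psi>_def f_def g_def h_def dot_bilinear vals)+
  have \<psi>: "dot I (\<psi> b) (\<psi> d) = ?B b d" for b d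
    unfolding \<psi>_def f_def g_def h_def
    by (simp add: dot_bilinear vals
          dot_commute [of I b u] dot_commute [of I b w] dot_commute [of I b c])
      (cases "dot I u b"; cases "dot I w b"; cases "dot I c b";
        cases "dot I u d"; cases "dot I w d"; cases "dot I c d"; simp add: add_ac)
  from gram have "almost_gram n ?B"
    by (rule almost_gram_pullback [where f = \<psi>]) (simp only: f g \<psi> mult_zero_left add_0_right)
  with n show ?thesis by blast
qed

section \<open>Decycling families as Gram matrices\<close>

lemma pair_wf_digraph_iff: "pair_wf_digraph D \<longleftrightarrow> parcs D \<subseteq> pverts D \<times> pverts D"
  by (auto simp: pair_wf_digraph_def)

lemma pair_fin_digraph_iff:
  "pair_fin_digraph D \<longleftrightarrow> finite (pverts D) \<and> parcs D \<subseteq> pverts D \<times> pverts D"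
  using finite_subset [of "parcs D" "pverts D \<times> pverts D"]
  by (auto simp: pair_fin_digraph_def pair_fin_digraph_axioms_def pair_wf_digraph_iff)

lemma oriented_graph_imp_pair_fin_digraph: "oriented_graph D \<Longrightarrow> pair_fin_digraph D"
  by (simp add: oriented_graph_def pair_digraph_def)

text \<open>Acyclicity after inversion is kept as an explicit ranking for an arbitrary form
  \<open>M\<close>, so that \<open>M\<close> can be modified without returning to sets. With integer
  ranks a block is reversed by negation and moved by translation.\<close>

definition ranks :: "('v \<Rightarrow> int) \<Rightarrow> ('v \<Rightarrow> 'v \<Rightarrow> bit) \<Rightarrow> 'v pair_pre_digraph \<Rightarrow> bool" where
  "ranks r M D \<longleftrightarrow> (\<forall>(x, y) \<in> parcs D. if M x y = 0 then r x < r y else r y < r x)"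

lemma ranksI:
  "(\<And>x y. (x, y) \<in> parcs D \<Longrightarrow> if M x y = 0 then r x < r y else r y < r x) \<Longrightarrow> ranks r M D"
  by (auto simp: ranks_def)

lemma ranksD:
  "ranks r M D \<Longrightarrow> (x, y) \<in> parcs D \<Longrightarrow> if M x y = 0 then r x < r y else r y < r x"
  unfolding ranks_def by blast

definition parity :: "'v set list \<Rightarrow> 'v \<Rightarrow> 'v \<Rightarrow> bit" where
  "parity Xs x y = (\<Sum>X\<leftarrow>Xs. of_bool (x \<in> X \<and> y \<in> X))"

definition realizable :: "'v pair_pre_digraph \<Rightarrow> nat \<Rightarrow> bool" where
  "realizable D m \<longleftrightarrow> (\<exists>M r. gram m M \<and> ranks r M D)"

definition even_realizable :: "'v pair_pre_digraph \<Rightarrow> nat \<Rightarrow> bool" where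
  "even_realizable D m \<longleftrightarrow> (\<exists>M r. even_gram m M \<and> ranks r M D)"

lemma even_realizable_imp_realizable: "even_realizable D m \<Longrightarrow> realizable D m"
  by (auto simp: even_realizable_def realizable_def even_gram_def)

text \<open>An inversion keeps the pair of ends of an arc, and \<open>parity\<close> is symmetric.
  So earlier swaps do not affect which later sets contain both ends, and only the parity of their
  number counts.\<close>

lemma parcs_fold_invert:
  "parcs (fold invert Xs D) = (\<lambda>(x, y). if parity Xs x y = 0 then (x, y) else (y, x)) ` parcs D"
proof (induction Xs arbitrary: D)
  case Nil
  then show ?case by (auto simp: parity_def)
next
  case (Cons X Xs)
  have "parcs (fold invert (X # Xs) D) =
      (\<lambda>e. (\<lambda>(x, y). if parity Xs x y = 0 then (x, y) else (y, x)) (swap_in (X \<times> X) e)) ` parcs D"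
    by (simp add: Cons.IH invert_def image_image)
  also have "\<dots> = (\<lambda>(x, y). if parity (X # Xs) x y = 0 then (x, y) else (y, x)) ` parcs D"
  proof (rule image_cong [OF refl], clarify)
    fix x y
    have "parity Xs y x = parity Xs x y" by (simp add: parity_def conj_commute)
    moreover have "parity (X # Xs) x y = of_bool (x \<in> X \<and> y \<in> X) + parity Xs x y"
      by (simp add: parity_def)
    ultimately show "(case swap_in (X \<times> X) (x, y) of
        (x, y) \<Rightarrow> if parity Xs x y = 0 then (x, y) else (y, x)) =
      (if parity (X # Xs) x y = 0 then (x, y) else (y, x))"
      by (cases "parity Xs x y") (auto simp: swap_in_def)
  qed
  finally show ?case .
qed

lemma no_directed_cycle_iff_acyclic:
  assumes "pair_wf_digraph D"
  shows "no_directed_cycle D \<longleftrightarrow> acyclic (parcs D)"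
proof -
  interpret pair_wf_digraph D by fact
  have "(\<exists>p. cycle p) \<longleftrightarrow> (\<exists>x. (x, x) \<in> (parcs D)\<^sup>+)"
  proof
    assume "\<exists>p. cycle p"
    then show "\<exists>x. (x, x) \<in> (parcs D)\<^sup>+"
      unfolding cycle_def by (metis reachable1_awalkI)
  next
    assume "\<exists>x. (x, x) \<in> (parcs D)\<^sup>+"
    then obtain x p where "awalk x p x" "p \<noteq> []"
      unfolding reachable1_awalk by auto
    then show "\<exists>p. cycle p"
      by (intro closed_w_imp_cycle) (auto simp: closed_w_def)
  qed
  then show ?thesis
    by (auto simp: no_directed_cycle_def acyclic_def)
qed

lemma acyclic_iff_rank:
  assumes "finite R"
  shows "acyclic R \<longleftrightarrow> (\<exists>r :: 'v \<Rightarrow> int. \<forall>(x, y) \<in> R. r x < r y)"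
proof
  assume "acyclic R"
  define r where "r x = int (card {y. (y, x) \<in> R\<^sup>+})" for x
  have "r x < r y" if "(x, y) \<in> R" for x y
  proof -
    have "finite {z. (z, y) \<in> R\<^sup>+}"
      by (rule finite_subset [of _ "fst ` (R\<^sup>+)"]) (use assms in \<open>force simp: finite_trancl\<close>)+
    \<comment> \<open>The inclusion is strict because \<open>x\<close> lies in the second set but,
      by acyclicity, not in the first.\<close>
    moreover have "{z. (z, x) \<in> R\<^sup>+} \<subset> {z. (z, y) \<in> R\<^sup>+}"
      using that \<open>acyclic R\<close> by (auto simp: acyclic_def psubset_eq intro: trancl_into_trancl)
    ultimately show ?thesis
      unfolding r_def by (simp add: psubset_card_mono)
  qed
  then show "\<exists>r :: 'v \<Rightarrow> int. \<forall>(x, y) \<in> R. r x < r y" by blast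
next
  assume "\<exists>r :: 'v \<Rightarrow> int. \<forall>(x, y) \<in> R. r x < r y"
  then obtain r :: "'v \<Rightarrow> int" where r: "\<And>x y. (x, y) \<in> R \<Longrightarrow> r x < r y" by blast
  have "r x < r y" if "(x, y) \<in> R\<^sup>+" for x y
    using that by induction (auto dest: r)
  then show "acyclic R" by (fastforce simp: acyclic_def)
qed

lemma no_directed_cycle_fold_invert_iff:
  assumes "pair_fin_digraph D"
  shows "no_directed_cycle (fold invert Xs D) \<longleftrightarrow> (\<exists>r. ranks r (parity Xs) D)"
proof -
  have verts: "pverts (fold invert Xs D) = pverts D"
    by (induction Xs arbitrary: D) (simp_all add: invert_def)
  have "parcs (fold invert Xs D) \<subseteq> pverts D \<times> pverts D"
    using assms by (force simp: parcs_fold_invert pair_fin_digraph_iff split: if_splits)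
  then have "pair_wf_digraph (fold invert Xs D)"
    by (simp add: pair_wf_digraph_iff verts)
  moreover have "finite (parcs (fold invert Xs D))"
    using pair_fin_digraph.pair_finite_arcs [OF assms] by (simp add: parcs_fold_invert)
  moreover have "(\<forall>(x, y) \<in> parcs (fold invert Xs D). r x < r y) \<longleftrightarrow> ranks r (parity Xs) D"
    for r :: "'a \<Rightarrow> int"
    unfolding parcs_fold_invert ranks_def ball_simps by (intro ball_cong) auto
  ultimately show ?thesis
    by (simp add: no_directed_cycle_iff_acyclic acyclic_iff_rank)
qed

lemma parity_eq_dot: "parity Xs x y =
    dot {..<length Xs} (\<lambda>i. of_bool (x \<in> Xs ! i)) (\<lambda>i. of_bool (y \<in> Xs ! i))"
  unfolding parity_def dot_def sum_list_sum_nth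
  by (intro sum.cong) (auto simp: lessThan_atLeast0)

lemma ranks_cong:
  assumes "pair_wf_digraph D" "ranks r M D"
    and "\<And>x y. x \<in> pverts D \<Longrightarrow> y \<in> pverts D \<Longrightarrow> M' x y = M x y"
  shows "ranks r M' D"
proof (rule ranksI)
  fix x y
  assume xy: "(x, y) \<in> parcs D"
  then have "M' x y = M x y"
    using assms(1,3) by (auto simp: pair_wf_digraph_iff)
  then show "if M' x y = 0 then r x < r y else r y < r x"
    using ranksD [OF assms(2) xy] by simp
qed

lemma decycling_family_iff_realizable:
  assumes D: "pair_fin_digraph D"
  shows "(\<exists>Xs. length Xs = m \<and> decycling_family D Xs) \<longleftrightarrow> realizable D m"
proof
  assume "\<exists>Xs. length Xs = m \<and> decycling_family D Xs"
  then obtain Xs r where "length Xs = m" "ranks r (parity Xs) D"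
    using D by (auto simp: decycling_family_def no_directed_cycle_fold_invert_iff)
  moreover from this(1) have "gram m (parity Xs)"
    unfolding gram_def parity_eq_dot [abs_def]
    by (intro exI [of _ "\<lambda>x i. of_bool (x \<in> Xs ! i)"]) simp
  ultimately show "realizable D m" by (auto simp: realizable_def)
next
  assume "realizable D m"
  then obtain M r a where r: "ranks r M D" and M: "\<And>x y. M x y = dot {..<m} (a x) (a y)"
    by (auto simp: realizable_def gram_def)
  define Xs where "Xs = map (\<lambda>i. {x \<in> pverts D. a x i = 1}) [0..<m]"
  have "parity Xs x y = M x y" if "x \<in> pverts D" "y \<in> pverts D" for x y
  proof -
    have "of_bool (x \<in> Xs ! i) = a x i" "of_bool (y \<in> Xs ! i) = a y i" if "i < m" for i
      using that \<open>x \<in> pverts D\<close> \<open>y \<in> pverts D\<close>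
      by (cases "a x i"; cases "a y i"; simp add: Xs_def)+
    moreover have "length Xs = m" by (simp add: Xs_def)
    ultimately show ?thesis
      unfolding parity_eq_dot M dot_def by (intro sum.cong) auto
  qed
  then have "ranks r (parity Xs) D"
    using ranks_cong r D pair_fin_digraph.axioms(1) by metis
  then have "decycling_family D Xs"
    using D by (auto simp: decycling_family_def no_directed_cycle_fold_invert_iff Xs_def)
  then show "\<exists>Xs. length Xs = m \<and> decycling_family D Xs"
    by (intro exI [of _ Xs]) (simp add: Xs_def)
qed

section \<open>The inversion number as a least length of vectors\<close>

lemma inversion_number_eq_Least:
  "pair_fin_digraph D \<Longrightarrow> inversion_number D = (LEAST m. realizable D m)"
  by (simp add: inversion_number_def decycling_family_iff_realizable)

lemma inversion_number_le: "pair_fin_digraph D \<Longrightarrow> realizable D m \<Longrightarrow> inversion_number D \<le> m"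
  by (simp add: inversion_number_eq_Least Least_le)

lemma realizableI:
  assumes "finite I" and "\<And>x y. M x y = dot I (a x) (a y)" and "ranks r M D"
  shows "realizable D (card I)"
  using gramI [of I M a] assms by (auto simp: realizable_def)

text \<open>There is one coordinate for each arc going backwards in an injective numbering. Without
  digons no other arc has the same two ends, so each coordinate reverses only its own arc.\<close>

lemma oriented_graph_realizable:
  assumes "oriented_graph D"
  shows "\<exists>m. realizable D m"
proof -
  interpret oriented_graph D by fact
  obtain f :: "'a \<Rightarrow> nat" where f: "inj_on f (pverts D)"
    using finite_imp_inj_to_nat_seg [OF pair_finite_verts] by blast
  define I where "I = {(x, y) \<in> parcs D. f y < f x}"
  have fin: "finite I"
    by (rule finite_subset [OF _ pair_finite_arcs]) (auto simp: I_def)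
  define a :: "'a \<Rightarrow> 'a \<times> 'a \<Rightarrow> bit" where "a x e = of_bool (x = fst e \<or> x = snd e)" for x e
  have "dot I (a x) (a y) = of_bool ((x, y) \<in> I)" if "(x, y) \<in> parcs D" for x y
  proof -
    have "x \<noteq> y" using that no_loops' by auto
    then have "a x e * a y e = (if e = (x, y) then 1 else 0)" if "e \<in> I" for e
      using that no_digon [OF \<open>(x, y) \<in> parcs D\<close>] by (cases e) (auto simp: a_def I_def)
    then have "dot I (a x) (a y) = (\<Sum>e\<in>I. if e = (x, y) then 1 else 0)"
      unfolding dot_def by (intro sum.cong) auto
    also have "\<dots> = of_bool ((x, y) \<in> I)" using fin by simp
    finally show ?thesis .
  qed
  moreover have "f x < f y" if "(x, y) \<in> parcs D" "(x, y) \<notin> I" for x y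
    using that f no_loops' in_arcsD1 in_arcsD2 unfolding I_def inj_on_def
    by (metis (mono_tags, lifting) case_prodI linorder_neqE_nat mem_Collect_eq)
  ultimately have "ranks (\<lambda>x. int (f x)) (\<lambda>x y. dot I (a x) (a y)) D"
    by (auto simp: ranks_def I_def)
  then show ?thesis
    using realizableI [of I "\<lambda>x y. dot I (a x) (a y)" a] fin by auto
qed

lemma realizable_inversion_number:
  assumes "oriented_graph D"
  shows "realizable D (inversion_number D)"
  using oriented_graph_realizable [OF assms] oriented_graph_imp_pair_fin_digraph [OF assms]
  by (metis LeastI_ex inversion_number_eq_Least)

section \<open>Dijoins\<close>

lemma finite_int_bound:
  assumes "finite A"
  obtains N :: int where "\<And>x. x \<in> A \<Longrightarrow> \<bar>r x\<bar> < N"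
proof -
  have "\<exists>N. \<forall>x\<in>A. \<bar>r x\<bar> < N"
    using assms
  proof induction
    case (insert x A)
    then obtain N where "\<forall>x\<in>A. \<bar>r x\<bar> < N" by blast
    then have "\<forall>y\<in>insert x A. \<bar>r y\<bar> < max N (\<bar>r x\<bar> + 1)" by force
    then show ?case by blast
  qed simp
  then show thesis using that by blast
qed

text \<open>Inside each of the blocks cut out by two nested initial segments, all pairs are inverted or
  none, and the same holds between the first two blocks. So the inverted order is obtained by
  reversing blocks and exchanging the first two.\<close>

lemma ranks_nested_segments:
  assumes D: "pair_fin_digraph D" and r: "ranks r M D" and pq: "p \<le> q"
    and U: "\<And>x. x \<in> pverts D \<Longrightarrow> U x = of_bool (r x < p)"
    and W: "\<And>x. x \<in> pverts D \<Longrightarrow> W x = of_bool (r x < q)"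
  shows "\<exists>r'. ranks r'
    (\<lambda>x y. M x y + (\<alpha> * (U x * U y) + \<beta> * (U x * W y + W x * U y) + \<gamma> * (W x * W y))) D"
proof -
  obtain N where N: "\<And>x. x \<in> pverts D \<Longrightarrow> \<bar>r x\<bar> < N"
    using finite_int_bound [OF pair_fin_digraph.pair_finite_verts [OF D]] by blast
  \<comment> \<open>The blocks get ranks within \<open>N\<close> of \<open>K\<close>,
    \<open>3 * N\<close> and \<open>9 * N\<close>, so \<open>K = 6 * N\<close> moves the first block
    past the second but not past the third. Inside the first block the \<beta> terms cancel and
    \<alpha> + \<gamma> decides; between the first two blocks \<beta> + \<gamma> does.\<close>
  define K where "K = (if \<beta> + \<gamma> = 1 then 6 * N else 0)"
  define r' where "r' x =
    (if r x < p then (if \<alpha> + \<gamma> = 1 then - r x else r x) + K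
     else if r x < q then (if \<gamma> = 1 then - r x else r x) + 3 * N
     else r x + 9 * N)" for x
  have "if M x y + (\<alpha> * (U x * U y) + \<beta> * (U x * W y + W x * U y) + \<gamma> * (W x * W y)) = 0
      then r' x < r' y else r' y < r' x" (is "if M x y + ?T = 0 then _ else _")
    if xy: "(x, y) \<in> parcs D" for x y
  proof -
    have V: "x \<in> pverts D" "y \<in> pverts D"
      using xy D by (auto simp: pair_fin_digraph_iff)
    have bounds: "- N < r x" "r x < N" "- N < r y" "r y < N"
      using N [OF V(1)] N [OF V(2)] by linarith+
    have M: "M x y = 0 \<Longrightarrow> r x < r y" "M x y = 1 \<Longrightarrow> r y < r x"
      using ranksD [OF r xy] by auto
    note UW = U [OF V(1)] U [OF V(2)] W [OF V(1)] W [OF V(2)]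
    have K: "\<beta> + \<gamma> = 0 \<Longrightarrow> K = 0" "\<beta> + \<gamma> = 1 \<Longrightarrow> K = 6 * N"
      by (simp_all add: K_def)
    consider "r x < p" "r y < p" | "r x < p" "p \<le> r y" "r y < q" | "p \<le> r x" "r x < q" "r y < p"
      | "p \<le> r x" "r x < q" "p \<le> r y" "r y < q" | "q \<le> r x" | "q \<le> r y"
      by (meson linorder_not_less)
    then show ?thesis
    proof cases
      case 1
      then have "?T = \<alpha> + \<gamma>" "r' x = (if \<alpha> + \<gamma> = 1 then - r x else r x) + K"
        "r' y = (if \<alpha> + \<gamma> = 1 then - r y else r y) + K"
        using pq by (simp_all add: UW r'_def)
      then show ?thesis
        using M by (cases "M x y"; cases "\<alpha> + \<gamma>") simp_all
    next
      case 2
      then have "?T = \<beta> + \<gamma>" "\<bar>r' x - K\<bar> < N" "\<bar>r' y - 3 * N\<bar> < N"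
        using pq N [OF V(1)] N [OF V(2)] by (simp_all add: UW r'_def)
      moreover have "M x y = 0"
        using 2 M(2) by (cases "M x y") simp_all
      ultimately show ?thesis
        using K by (cases "\<beta> + \<gamma>") simp_all
    next
      case 3
      then have "?T = \<beta> + \<gamma>" "\<bar>r' y - K\<bar> < N" "\<bar>r' x - 3 * N\<bar> < N"
        using pq N [OF V(1)] N [OF V(2)] by (simp_all add: UW r'_def)
      moreover have "M x y = 1"
        using 3 M(1) by (cases "M x y") simp_all
      ultimately show ?thesis
        using K by (cases "\<beta> + \<gamma>") simp_all
    next
      case 4
      then have "?T = \<gamma>" "r' x = (if \<gamma> = 1 then - r x else r x) + 3 * N"
        "r' y = (if \<gamma> = 1 then - r y else r y) + 3 * N"
        by (simp_all add: UW r'_def)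
      then show ?thesis
        using M by (cases "M x y"; cases \<gamma>) simp_all
    next
      case 5
      then have "?T = 0" "r' x = r x + 9 * N"
        using pq by (simp_all add: UW r'_def)
      moreover have "r' y = r y + 9 * N \<or> r y < q \<and> r' y < 8 * N"
        using pq bounds by (auto simp: r'_def K_def)
      ultimately show ?thesis
        using M 5 bounds by (cases "M x y") auto
    next
      case 6
      then have "?T = 0" "r' y = r y + 9 * N"
        using pq by (simp_all add: UW r'_def)
      moreover have "r' x = r x + 9 * N \<or> r x < q \<and> r' x < 8 * N"
        using pq bounds by (auto simp: r'_def K_def)
      ultimately show ?thesis
        using M 6 bounds by (cases "M x y") auto
    qed
  qed
  then show ?thesis by (intro exI [of _ r']) (auto simp: ranks_def)
qed

lemma ranks_segments:
  assumes D: "pair_fin_digraph D" and r: "ranks r M D"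
    and U: "\<And>x. x \<in> pverts D \<Longrightarrow> U x = of_bool (r x < p)"
    and W: "\<And>x. x \<in> pverts D \<Longrightarrow> W x = of_bool (r x < q)"
  shows "\<exists>r'. ranks r'
    (\<lambda>x y. M x y + (\<alpha> * (U x * U y) + \<beta> * (U x * W y + W x * U y) + \<gamma> * (W x * W y))) D"
proof (cases "p \<le> q")
  case True
  then show ?thesis using ranks_nested_segments [OF D r _ U W] by blast
next
  case False
  then show ?thesis
    using ranks_nested_segments [OF D r _ W U, where \<alpha> = \<gamma> and \<beta> = \<beta> and \<gamma> = \<alpha>]
    by (simp add: add_ac)
qed

section \<open>Segments of \<open>D2\<close> cut out by vertices of \<open>D1\<close>\<close>

lemma parcs_dijoin_simps [simp]:
  "(Inl u, Inl v) \<in> parcs (dijoin D1 D2) \<longleftrightarrow> (u, v) \<in> parcs D1"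
  "(Inr x, Inr y) \<in> parcs (dijoin D1 D2) \<longleftrightarrow> (x, y) \<in> parcs D2"
  "(Inl u, Inr x) \<in> parcs (dijoin D1 D2) \<longleftrightarrow> u \<in> pverts D1 \<and> x \<in> pverts D2"
  "(Inr x, Inl u) \<notin> parcs (dijoin D1 D2)"
  by (auto simp: dijoin_def)

lemma pair_fin_digraph_dijoin:
  assumes "pair_fin_digraph D1" "pair_fin_digraph D2"
  shows "pair_fin_digraph (dijoin D1 D2)"
  using assms by (auto simp: pair_fin_digraph_iff dijoin_def)

lemma ranks_dijoin_left: "ranks r M (dijoin D1 D2) \<Longrightarrow>
    ranks (\<lambda>x. r (Inl x)) (\<lambda>x y. M (Inl x) (Inl y)) D1"
  by (rule ranksI, rule ranksD [of r M "dijoin D1 D2" "Inl _" "Inl _"]) simp_all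

lemma ranks_dijoin_right: "ranks r M (dijoin D1 D2) \<Longrightarrow>
    ranks (\<lambda>x. r (Inr x)) (\<lambda>x y. M (Inr x) (Inr y)) D2"
  by (rule ranksI, rule ranksD [of r M "dijoin D1 D2" "Inr _" "Inr _"]) simp_all

text \<open>All arcs between the sides leave \<open>D1\<close>, so the arc from \<open>u\<close> to
  \<open>x\<close> has to be reversed exactly when \<open>x\<close> is ranked below
  \<open>u\<close>. This is the source of the nested initial segments.\<close>

lemma ranks_dijoin_cross:
  assumes "ranks r M (dijoin D1 D2)" "u \<in> pverts D1" "x \<in> pverts D2"
  shows "M (Inl u) (Inr x) = of_bool (r (Inr x) < r (Inl u))"
proof -
  have "(Inl u, Inr x) \<in> parcs (dijoin D1 D2)" using assms by simp
  then have "if M (Inl u) (Inr x) = 0 then r (Inl u) < r (Inr x) else r (Inr x) < r (Inl u)"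
    by (rule ranksD [OF assms(1)])
  then show ?thesis by (auto split: if_splits)
qed

text \<open>\<open>U\<close> and \<open>W\<close> are indicators of initial segments, so
  \<open>ranks_segments\<close> applies. The coefficients stay free because each kind of rank
  reduction needs its own combination.\<close>

lemma ranks_dijoin_segments:
  assumes "pair_fin_digraph D2" and r: "ranks r (\<lambda>x y. dot I (a x) (a y)) (dijoin D1 D2)"
    and "u \<in> pverts D1" "w \<in> pverts D1"
  defines "U \<equiv> \<lambda>x. dot I (a (Inl u)) (a (Inr x))" and "W \<equiv> \<lambda>x. dot I (a (Inl w)) (a (Inr x))"
  shows "\<exists>r'. ranks r' (\<lambda>x y. dot I (a (Inr x)) (a (Inr y)) +
    (\<alpha> * (U x * U y) + \<beta> * (U x * W y + W x * U y) + \<gamma> * (W x * W y))) D2"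
  unfolding U_def W_def
  by (rule ranks_segments [OF assms(1) ranks_dijoin_right [OF r]])
    (use ranks_dijoin_cross [OF r] assms(3,4) in blast)+

definition almost_realizable :: "'v pair_pre_digraph \<Rightarrow> nat \<Rightarrow> bool" where
  "almost_realizable D n \<longleftrightarrow> realizable D n \<or> even_realizable D (n + 1)"

lemma almost_realizableI:
  assumes "almost_gram n B" "\<exists>r. ranks r (\<lambda>x y. B (b x) (b y)) D"
  shows "almost_realizable D n"
proof -
  have "almost_gram n (\<lambda>x y. B (b x) (b y))"
    by (rule almost_gram_pullback [OF assms(1)]) simp
  then show ?thesis
    using assms(2) by (auto simp: almost_realizable_def realizable_def even_realizable_def almost_gram_def)
qed

text \<open>Reversing the segment of an odd vertex adds exactly the product that
  \<open>almost_gram_split_odd\<close> uses to lower the rank by one.\<close>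

lemma dijoin_odd_almost_realizable:
  assumes D2: "pair_fin_digraph D2" and r: "ranks r (\<lambda>x y. dot I (a x) (a y)) (dijoin D1 D2)"
    and I: "finite I" "card I = n + 1"
    and u: "u \<in> pverts D1" "dot I (a (Inl u)) (a (Inl u)) = 1"
  shows "almost_realizable D2 n"
  using ranks_dijoin_segments [OF D2 r u(1) u(1), where \<alpha> = 1 and \<beta> = 0 and \<gamma> = 0]
  by (intro almost_realizableI [OF almost_gram_split_odd [OF I u(2)], where b = "\<lambda>x. a (Inr x)"]) simp

text \<open>As squaring is the identity on \<open>bit\<close>, a violation of the second alternative
  says that the 2 by 2 Gram matrix of two vectors of \<open>D1\<close> is invertible. They span a
  nondegenerate plane, and splitting it off lowers the rank by two.\<close>

lemma dijoin_dichotomy: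
  assumes D2: "pair_fin_digraph D2" and r: "ranks r (\<lambda>x y. dot I (a x) (a y)) (dijoin D1 D2)"
    and I: "finite I"
  shows "(\<exists>n. card I = n + 2 \<and> almost_realizable D2 n) \<or>
    (\<forall>u\<in>pverts D1. \<forall>w\<in>pverts D1. dot I (a (Inl u)) (a (Inl w)) =
        dot I (a (Inl u)) (a (Inl u)) * dot I (a (Inl w)) (a (Inl w)))"
proof (rule disjCI, clarsimp)
  fix u w
  assume uw: "u \<in> pverts D1" "w \<in> pverts D1"
  define A where "A = a (Inl u)"
  define B where "B = a (Inl w)"
  define b where "b x = a (Inr x)" for x
  assume "dot I (a (Inl u)) (a (Inl w)) \<noteq>
    dot I (a (Inl u)) (a (Inl u)) * dot I (a (Inl w)) (a (Inl w))"
  then have neq: "dot I A B \<noteq> dot I A A * dot I B B" by (simp add: A_def B_def)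
  note seg = ranks_dijoin_segments [OF D2 r uw, folded A_def B_def b_def]
  have AB: "dot I B A = dot I A B" by (rule dot_commute)
  \<comment> \<open>These are the invertible symmetric 2 by 2 matrices: the hyperbolic plane, the
    orthonormal pair, and two cases where the odd vector and the sum of both vectors form an
    orthonormal pair.\<close>
  consider (even) "dot I A A = 0" "dot I B B = 0" "dot I A B = 1"
    | (odd) "dot I A A = 1" "dot I B B = 1" "dot I A B = 0"
    | (left) "dot I A A = 1" "dot I B B = 0" "dot I A B = 1"
    | (right) "dot I A A = 0" "dot I B B = 1" "dot I A B = 1"
    using neq by (cases "dot I A A"; cases "dot I B B"; cases "dot I A B"; simp)
  then show "\<exists>n. card I = Suc (Suc n) \<and> almost_realizable D2 n"
  proof cases
    case even
    then obtain n where "card I = n + 2" and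
      "almost_gram n (\<lambda>b c. dot I b c + (dot I A b * dot I B c + dot I B b * dot I A c))"
      using almost_gram_split_hyperbolic [OF I] by blast
    moreover from this(2) have "almost_realizable D2 n"
      using seg [of 0 1 0] by (elim almost_realizableI [where b = b]) simp
    ultimately show ?thesis by auto
  next
    case odd
    then obtain n where "card I = n + 2" and
      "almost_gram n (\<lambda>b c. dot I b c + dot I A b * dot I A c + dot I B b * dot I B c)"
      using almost_gram_split_orthogonal_odd [OF I] by blast
    moreover from this(2) have "almost_realizable D2 n"
      using seg [of 1 0 1] by (elim almost_realizableI [where b = b]) (simp add: add_ac)
    ultimately show ?thesis by auto
  next
    case left
    define C where "C = (\<lambda>i. A i + B i)"
    have C: "dot I C c = dot I A c + dot I B c" for c by (simp add: C_def dot_add_left)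
    have "dot I C C = 1" "dot I A C = 0"
      using left AB by (simp_all add: C_def dot_bilinear)
    then obtain n where "card I = n + 2" and
      "almost_gram n (\<lambda>b c. dot I b c + dot I A b * dot I A c + dot I C b * dot I C c)"
      using almost_gram_split_orthogonal_odd [OF I left(1)] by blast
    moreover from this(2) have "almost_realizable D2 n"
    proof (rule almost_realizableI [where b = b])
      \<comment> \<open>Expanding \<open>C\<close> as \<open>A + B\<close> cancels the products of
        \<open>A\<close> with itself, which leaves the coefficients 0, 1, 1.\<close>
      have eq: "dot I (b x) (b y) + dot I A (b x) * dot I A (b y) + dot I C (b x) * dot I C (b y) =
          dot I (b x) (b y) + (0 * (dot I A (b x) * dot I A (b y)) +
            1 * (dot I A (b x) * dot I B (b y) + dot I B (b x) * dot I A (b y)) +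
            1 * (dot I B (b x) * dot I B (b y)))" for x y
        unfolding C by (cases "dot I A (b x)"; cases "dot I A (b y)"; cases "dot I B (b x)";
            cases "dot I B (b y)"; simp add: add_ac)
      show "\<exists>r. ranks r (\<lambda>x y. dot I (b x) (b y) + dot I A (b x) * dot I A (b y) +
          dot I C (b x) * dot I C (b y)) D2"
        unfolding eq by (rule seg)
    qed
    ultimately show ?thesis by auto
  next
    case right
    define C where "C = (\<lambda>i. A i + B i)"
    have C: "dot I C c = dot I A c + dot I B c" for c by (simp add: C_def dot_add_left)
    have "dot I C C = 1" "dot I B C = 0"
      using right AB by (simp_all add: C_def dot_bilinear)
    then obtain n where "card I = n + 2" and
      "almost_gram n (\<lambda>b c. dot I b c + dot I B b * dot I B c + dot I C b * dot I C c)"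
      using almost_gram_split_orthogonal_odd [OF I right(2)] by blast
    moreover from this(2) have "almost_realizable D2 n"
    proof (rule almost_realizableI [where b = b])
      have eq: "dot I (b x) (b y) + dot I B (b x) * dot I B (b y) + dot I C (b x) * dot I C (b y) =
          dot I (b x) (b y) + (1 * (dot I A (b x) * dot I A (b y)) +
            1 * (dot I A (b x) * dot I B (b y) + dot I B (b x) * dot I A (b y)) +
            0 * (dot I B (b x) * dot I B (b y)))" for x y
        unfolding C by (cases "dot I A (b x)"; cases "dot I A (b y)"; cases "dot I B (b x)";
            cases "dot I B (b y)"; simp add: add_ac)
      show "\<exists>r. ranks r (\<lambda>x y. dot I (b x) (b y) + dot I B (b x) * dot I B (b y) +
          dot I C (b x) * dot I C (b y)) D2"
        unfolding eq by (rule seg)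
    qed
    ultimately show ?thesis by auto
  qed
qed

section \<open>Families for a dijoin built from its two sides\<close>

lemma ranks_dijoin:
  assumes D1: "pair_fin_digraph D1" and D2: "pair_fin_digraph D2"
    and r1: "ranks r1 (\<lambda>x y. M (Inl x) (Inl y)) D1" and r2: "ranks r2 (\<lambda>x y. M (Inr x) (Inr y)) D2"
    and cross: "\<And>x y. M (Inl x) (Inr y) = 0"
  shows "\<exists>r. ranks r M (dijoin D1 D2)"
proof -
  obtain N1 where N1: "\<And>x. x \<in> pverts D1 \<Longrightarrow> \<bar>r1 x\<bar> < N1"
    using finite_int_bound [OF pair_fin_digraph.pair_finite_verts [OF D1]] by blast
  obtain N2 where N2: "\<And>x. x \<in> pverts D2 \<Longrightarrow> \<bar>r2 x\<bar> < N2"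
    using finite_int_bound [OF pair_fin_digraph.pair_finite_verts [OF D2]] by blast
  have "ranks (case_sum r1 (\<lambda>x. r2 x + N1 + N2)) M (dijoin D1 D2)"
    using r1 r2 cross N1 N2 by (fastforce simp: ranks_def dijoin_def)
  then show ?thesis by blast
qed

text \<open>Disjoint sets of coordinates for the two sides make all cross products zero.\<close>

lemma realizable_dijoin_add:
  assumes D: "pair_fin_digraph D1" "pair_fin_digraph D2"
    and "realizable D1 m" "realizable D2 n"
  shows "realizable (dijoin D1 D2) (m + n)"
proof -
  obtain M1 r1 a1 where r1: "ranks r1 M1 D1" and M1: "\<And>x y. M1 x y = dot {..<m} (a1 x) (a1 y)"
    using assms(3) by (auto simp: realizable_def gram_def)
  obtain M2 r2 a2 where r2: "ranks r2 M2 D2" and M2: "\<And>x y. M2 x y = dot {..<n} (a2 x) (a2 y)"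
    using assms(4) by (auto simp: realizable_def gram_def)
  define I where "I = {..<m} <+> {..<n}"
  define a where "a = case_sum (\<lambda>u. case_sum (a1 u) (\<lambda>_. 0)) (\<lambda>x. case_sum (\<lambda>_. 0) (a2 x))"
  have "\<exists>r. ranks r (\<lambda>x y. dot I (a x) (a y)) (dijoin D1 D2)"
    using r1 r2 by (intro ranks_dijoin [OF D])
      (simp_all add: dot_def I_def a_def sum.Plus M1 [abs_def] M2 [abs_def])
  moreover have "finite I" "card I = m + n"
    by (simp_all add: I_def card_Plus)
  ultimately show ?thesis
    using realizableI [of I "\<lambda>x y. dot I (a x) (a y)" a] by auto
qed

text \<open>For odd \<open>k\<close> the all-ones vector of length \<open>k\<close> is odd and orthogonal to all even vectors, so it
  can replace one coordinate of \<open>D1\<close>.\<close>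

lemma realizable_dijoin_even:
  assumes D: "pair_fin_digraph D1" "pair_fin_digraph D2"
    and "realizable D1 (n + 1)" "even_realizable D2 k"
  shows "realizable (dijoin D1 D2) (n + k)"
proof -
  obtain M1 r1 a1 where r1: "ranks r1 M1 D1" and M1: "\<And>x y. M1 x y = dot {..<n + 1} (a1 x) (a1 y)"
    using assms(3) by (auto simp: realizable_def gram_def)
  obtain M2 r2 a2 where r2: "ranks r2 M2 D2" and M2: "\<And>x y. M2 x y = dot {..<k} (a2 x) (a2 y)"
    and even: "\<And>x. M2 x x = 0" and k: "odd k"
    using assms(4) by (auto simp: even_realizable_def gram_def even_gram_def)
  have even': "(\<Sum>i<k. a2 x i) = 0" for x
    using even [of x] by (simp add: M2 dot_self)
  have k1: "of_nat k = (1 :: bit)"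
    using k even_of_nat [of k, where ?'a = bit] by (cases "of_nat k :: bit") auto
  define I where "I = {..<n} <+> {..<k}"
  \<comment> \<open>The last coordinate of \<open>u\<close> is repeated \<open>k\<close> times.
    Inside \<open>D1\<close> it contributes \<open>k\<close> equal products, which add up to one of
    them as \<open>k\<close> is odd; against \<open>D2\<close> it is multiplied by the coordinate
    sum of an even vector, which is 0.\<close>
  define a where "a = case_sum (\<lambda>u. case_sum (a1 u) (\<lambda>_. a1 u n)) (\<lambda>x. case_sum (\<lambda>_. 0) (a2 x))"
  have "\<exists>r. ranks r (\<lambda>x y. dot I (a x) (a y)) (dijoin D1 D2)"
    using r1 r2 by (intro ranks_dijoin [OF D])
      (simp_all add: dot_def I_def a_def sum.Plus M1 [abs_def] M2 [abs_def] k1 even'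
        flip: sum_distrib_left)
  moreover have "finite I" "card I = n + k"
    by (simp_all add: I_def card_Plus)
  ultimately show ?thesis
    using realizableI [of I "\<lambda>x y. dot I (a x) (a y)" a] by auto
qed

lemma dijoin_realizable_right: "realizable (dijoin D1 D2) m \<Longrightarrow> realizable D2 m"
  unfolding realizable_def
  using ranks_dijoin_right gram_pullback [where f = Inr, OF _ refl] by metis

section \<open>Inversion numbers of dijoins\<close>

lemma inversion_number_le_almost_realizable:
  assumes "pair_fin_digraph D" "almost_realizable D n"
  shows "inversion_number D \<le> n + 1"
proof -
  have "realizable D n \<or> realizable D (n + 1)"
    using assms(2) even_realizable_imp_realizable unfolding almost_realizable_def by blast
  then show ?thesis
    by (auto dest: inversion_number_le [OF assms(1)])
qed

text \<open>The matrix comes from the single set on which \<open>s\<close> is 1. This interprets the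
  degenerate alternative of \<open>dijoin_dichotomy\<close>.\<close>

lemma realizable_rank_one:
  assumes "pair_wf_digraph D" "ranks r M D"
    and "\<And>x y. x \<in> pverts D \<Longrightarrow> y \<in> pverts D \<Longrightarrow> M x y = s x * s y"
  shows "realizable D 1"
proof -
  have "ranks r (\<lambda>x y. s x * s y) D"
    by (rule ranks_cong [OF assms(1,2)]) (simp add: assms(3))
  then show ?thesis
    using realizableI [of "{0 :: nat}" "\<lambda>x y. s x * s y" "\<lambda>x _. s x"] by (simp add: dot_def)
qed

text \<open>In the degenerate alternative of \<open>dijoin_dichotomy\<close> one set would decycle
  \<open>D1\<close>, so the rank drops by two.\<close>

lemma dijoin_realizable_imp_almost_realizable:
  assumes D: "pair_fin_digraph D1" "pair_fin_digraph D2"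
    and "inversion_number D1 \<ge> 2" "realizable (dijoin D1 D2) m"
  shows "\<exists>n. m = n + 2 \<and> almost_realizable D2 n"
proof -
  obtain a r where r: "ranks r (\<lambda>x y. dot {..<m} (a x) (a y)) (dijoin D1 D2)"
    using assms(4) by (auto simp: realizable_def gram_def fun_eq_iff [symmetric])
  have "\<not> realizable D1 1"
    using inversion_number_le [OF D(1)] assms(3) by fastforce
  moreover have "realizable D1 1"
    if "\<forall>u\<in>pverts D1. \<forall>w\<in>pverts D1. dot {..<m} (a (Inl u)) (a (Inl w)) =
        dot {..<m} (a (Inl u)) (a (Inl u)) * dot {..<m} (a (Inl w)) (a (Inl w))"
    by (rule realizable_rank_one [OF pair_fin_digraph.axioms(1) [OF D(1)] ranks_dijoin_left [OF r]],
        rule that [rule_format])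
  ultimately show ?thesis
    using dijoin_dichotomy [OF D(2) r finite_lessThan, unfolded card_lessThan] by blast
qed

lemma pair_fin_digraph_C3: "pair_fin_digraph directed_C3"
  by unfold_locales (auto simp: directed_C3_def)

text \<open>Inverting \<open>{0, 1}\<close> leaves the transitive order 1, 2, 0.\<close>

lemma realizable_C3: "realizable directed_C3 1"
  by (rule realizable_rank_one [OF pair_fin_digraph.axioms(1) [OF pair_fin_digraph_C3],
        where s = "\<lambda>x. of_bool (x < 2)" and r = "\<lambda>x. if x = 0 then 2 else int x - 1" and
          M = "\<lambda>x y. of_bool (x < 2) * of_bool (y < 2)"])
    (auto simp: ranks_def directed_C3_def)

text \<open>In the degenerate alternative some vertex of the triangle has an odd vector, since
  otherwise no arc of the triangle is reversed and its cycle survives. That vector still lowers the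
  rank by one.\<close>

lemma dijoin_C3_realizable_imp_almost_realizable:
  assumes D: "pair_fin_digraph D"
    and "realizable (dijoin directed_C3 D) m"
  shows "\<exists>n. (m = n + 1 \<or> m = n + 2) \<and> almost_realizable D n"
proof -
  obtain a r where r: "ranks r (\<lambda>x y. dot {..<m} (a x) (a y)) (dijoin directed_C3 D)"
    using assms(2) by (auto simp: realizable_def gram_def fun_eq_iff [symmetric])
  let ?s = "\<lambda>u. dot {..<m} (a (Inl u)) (a (Inl u))"
  from dijoin_dichotomy [OF D r] consider n where "m = n + 2" "almost_realizable D n"
    | "\<forall>u\<in>pverts directed_C3. \<forall>w\<in>pverts directed_C3. dot {..<m} (a (Inl u)) (a (Inl w)) = ?s u * ?s w"
    by auto
  then show ?thesis
  proof cases
    case 2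
    have "ranks (\<lambda>x. r (Inl x)) (\<lambda>x y. ?s x * ?s y) directed_C3"
      by (rule ranks_cong [OF pair_fin_digraph.axioms(1) [OF pair_fin_digraph_C3]
            ranks_dijoin_left [OF r]], rule 2 [rule_format, symmetric])
    then have "\<not> (?s 0 = 0 \<and> ?s 1 = 0 \<and> ?s 2 = 0)"
      by (auto simp: ranks_def directed_C3_def)
    then have "\<exists>u\<in>{0, 1, 2}. ?s u = 1"
      by auto
    then obtain u where u: "u \<in> pverts directed_C3" "?s u = 1"
      by (auto simp: directed_C3_def)
    then have "m \<noteq> 0" by (intro notI) (simp add: dot_def)
    then obtain n where "m = n + 1" by (cases m) auto
    then show ?thesis
      using dijoin_odd_almost_realizable [OF D r _ _ u] by auto
  qed auto
qed

lemma realizable_dijoin_inversion_number: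
  assumes "pair_fin_digraph D1" "pair_fin_digraph D2" "realizable D1 m" "realizable D2 n"
  shows "realizable (dijoin D1 D2) (inversion_number (dijoin D1 D2))"
  unfolding inversion_number_eq_Least [OF pair_fin_digraph_dijoin [OF assms(1,2)]]
  by (rule LeastI, rule realizable_dijoin_add, fact+)

text \<open>A family of \<open>d\<close> sets makes \<open>D2\<close> almost realizable with
  \<open>d - 2\<close>, so \<open>k\<close> is at most \<open>d - 1\<close>. In case of equality the
  minimality of \<open>k\<close> rules out realizability with \<open>k - 1\<close> and only the
  alternating case is left. Conversely, one of the two coordinates of \<open>D1\<close> is absorbed
  by the all-ones vector.\<close>

lemma inversion_number_dijoin_eq_add_1_iff:
  assumes "oriented_graph D1" and "oriented_graph D2" and inv1: "inversion_number D1 = 2"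
  defines "k \<equiv> inversion_number D2" and "d \<equiv> inversion_number (dijoin D1 D2)"
  shows "d = k + 1 \<or> d = k + 2" and "d = k + 1 \<longleftrightarrow> even_realizable D2 k"
proof -
  have D1: "pair_fin_digraph D1" and D2: "pair_fin_digraph D2"
    by (rule oriented_graph_imp_pair_fin_digraph, fact)+
  have real: "realizable D1 2" "realizable D2 k"
    using realizable_inversion_number [OF assms(1)] realizable_inversion_number [OF assms(2)] inv1
    by (simp_all add: k_def)
  note d_le = inversion_number_le [OF pair_fin_digraph_dijoin [OF D1 D2], folded d_def]
  have upper: "d \<le> k + 2"
    using d_le [OF realizable_dijoin_add [OF D1 D2 real]] by simp
  have "realizable (dijoin D1 D2) d"
    unfolding d_def by (rule realizable_dijoin_inversion_number [OF D1 D2 real])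
  then obtain n where n: "d = n + 2" "almost_realizable D2 n"
    using dijoin_realizable_imp_almost_realizable [OF D1 D2] inv1 by auto
  have lower: "k + 1 \<le> d"
    using inversion_number_le_almost_realizable [OF D2 n(2)] n(1) by (simp add: k_def)
  show "d = k + 1 \<or> d = k + 2"
    using upper lower by linarith
  show "d = k + 1 \<longleftrightarrow> even_realizable D2 k"
  proof
    assume "d = k + 1"
    then have k: "k = n + 1"
      using n(1) by simp
    then have "\<not> realizable D2 n"
      using inversion_number_le [OF D2, of n] by (auto simp: k_def)
    with n(2) show "even_realizable D2 k"
      by (simp add: almost_realizable_def k)
  next
    assume "even_realizable D2 k"
    then have "d \<le> 1 + k"
      by (intro d_le realizable_dijoin_even [OF D1 D2] real(1) [folded one_add_one])
    then show "d = k + 1" using lower by simp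
  qed
qed

text \<open>From \<open>c = k\<close> the rank drops by one or two. A drop by two contradicts the
  minimality of \<open>k\<close>, and a drop by one leaves only the alternating case.\<close>

lemma inversion_number_dijoin_C3_eq_iff:
  assumes "oriented_graph D"
  defines "k \<equiv> inversion_number D" and "c \<equiv> inversion_number (dijoin directed_C3 D)"
  shows "c = k \<longleftrightarrow> even_realizable D k"
proof -
  have D: "pair_fin_digraph D"
    by (rule oriented_graph_imp_pair_fin_digraph, fact)
  have c: "realizable (dijoin directed_C3 D) c"
    unfolding c_def
    by (rule realizable_dijoin_inversion_number [OF pair_fin_digraph_C3 D realizable_C3
          realizable_inversion_number [OF assms(1)]])
  show ?thesis
  proof
    assume "c = k"
    then obtain n where n: "k = n + 1 \<or> k = n + 2" "almost_realizable D n"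
      using dijoin_C3_realizable_imp_almost_realizable [OF D c] by auto
    then have k: "k = n + 1"
      using inversion_number_le_almost_realizable [OF D n(2), folded k_def] by linarith
    then have "\<not> realizable D n"
      using inversion_number_le [OF D, of n] by (auto simp: k_def)
    with n(2) show "even_realizable D k"
      by (simp add: almost_realizable_def k)
  next
    assume "even_realizable D k"
    \<comment> \<open>With \<open>n = 0\<close> the only coordinate of the triangle becomes the
      all-ones vector on the coordinates of \<open>D\<close>, so no set is added.\<close>
    then have "realizable (dijoin directed_C3 D) (0 + k)"
      using realizable_C3 by (intro realizable_dijoin_even [OF pair_fin_digraph_C3 D]) simp_all
    then have "c \<le> k"
      unfolding c_def
      by (intro inversion_number_le [OF pair_fin_digraph_dijoin [OF pair_fin_digraph_C3 D]]) simp
    moreover have "k \<le> c"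
      unfolding k_def by (rule inversion_number_le [OF D dijoin_realizable_right [OF c]])
    ultimately show "c = k" by simp
  qed
qed

theorem theorem1p1:
  fixes D1 :: "'a pair_pre_digraph" and D2 :: "'b pair_pre_digraph" and k :: nat
  assumes "oriented_graph D1" and "oriented_graph D2"
    and "inversion_number D1 = 2" and "inversion_number D2 = k"
  shows "(inversion_number (dijoin D1 D2) = k + 2 \<or>
           inversion_number (dijoin D1 D2) = k + 1 \<and> odd k) \<and>
         (inversion_number (dijoin D1 D2) = k + 1 \<longleftrightarrow>
           inversion_number (dijoin directed_C3 D2) = k)"
proof -
  have "odd k" if "even_realizable D2 k"
    using that by (auto simp: even_realizable_def even_gram_def)
  then show ?thesis
    using inversion_number_dijoin_eq_add_1_iff [OF assms(1-3)]
      inversion_number_dijoin_C3_eq_iff [OF assms(2)]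
    unfolding assms(4) by blast
qed

end
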